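(* Let $S$ be a string over an alphabet of size $\sigma$, $n=|S|$, let $k\ge 0$ be an integer, and let $Y_S = y_1 y_2 \cdots y_{|Y_S|}$ be a parsing of $S$ with $|y_i| \geq k$ for all $i$. Let $L$ be the string $|y_1|\,|y_2|\cdots|y_{|Y_S|}|$ of phrase lengths (a string over the alphabet $\{1,\ldots,n\}$). Then $$|Y_S| H_1(Y_S) \leq |S|H_k(S) + |L| H_0(L).$$ Moreover, if $|Y_S| = O(|S|/\log_\sigma |S|)$, then $$|Y_S| H_1(Y_S) \leq |S|H_k(S) + O\!\left( \frac{|S|\cdot \log \log |S|}{\log_\sigma |S|} \right).$$
   Context: All logarithms are base 2. For a string $T$ over an alphabet $\Gamma$ and a letter $a$, let $|T|_a$ be the number of occurrences of $a$ in $T$. The zeroth-order empirical entropy is $H_0(T) = -\sum_{a} \frac{|T|_a}{|T|}\log\frac{|T|_a}{|T|}$ (and $|T|H_0(T)=0$ for empty $T$). For $k\ge 1$, the $k$-th order empirical entropy is defined by $|T|H_k(T) = \sum_{w \in \Gamma^k} |T_w| H_0(T_w)$, where $T_w$ is the string obtained by concatenating, in order, all letters of $T$ that are immediately preceded by an occurrence of $w$ (e.g. for $T=abacaac$, $T_a=bcac$). A parsing of $S$ is a sequence $Y_S=y_1,\ldots,y_t$ of nonempty strings whose concatenation is $S$; $|Y_S|=t$. The parsing is viewed as a string of length $t$ over a new alphabet whose letters are the distinct phrases, and $H_0(Y_S)$, $H_1(Y_S)$ are the empirical entropies of this string. *)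

theory Defs
  imports Complex_Main "HOL-Library.Landau_Symbols"
begin

text \<open>
  Letters that do not occur in the string contribute \<open>0\<close> (by \<open>0 log 0 = 0\<close>), so the sum
  ranges over the occurring letters only; the empty string gets entropy \<open>0\<close>.
\<close>

definition entropy0 :: "'a list \<Rightarrow> real" where
  "entropy0 T = - (\<Sum>a\<in>set T. real (count_list T a) / real (length T)
                     * log 2 (real (count_list T a) / real (length T)))"

text \<open>
  \<open>following w T\<close> is the string $T_w$; occurrences of \<open>w\<close> may overlap.
\<close>

definition following :: "'a list \<Rightarrow> 'a list \<Rightarrow> 'a list" where
  "following w T =
     map (\<lambda>i. T ! i)
       (filter (\<lambda>i. take (length w) (drop (i - length w) T) = w) [length w..<length T])"

lemma "following [CHR ''a''] ''abacaac'' = ''bcac''"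
  by code_simp

text \<open>
  The \<open>k\<close>-th order empirical entropy of a string over the alphabet \<open>\<Gamma>\<close>, normalised by the
  length of the string (the value for the empty string is \<open>0\<close>).
\<close>

definition entropy :: "'a set \<Rightarrow> nat \<Rightarrow> 'a list \<Rightarrow> real" where
  "entropy \<Gamma> k T =
     (if k = 0 then entropy0 T
      else (\<Sum>w\<in>{w. set w \<subseteq> \<Gamma> \<and> length w = k}.
              real (length (following w T)) * entropy0 (following w T)) / real (length T))"

definition parsing :: "'a list list \<Rightarrow> 'a list \<Rightarrow> bool" where
  "parsing Y S \<longleftrightarrow> concat Y = S \<and> (\<forall>y\<in>set Y. y \<noteq> [])"

end

theory Submission
  imports Defs
begin

text \<open>
  By Gibbs' inequality, the first-order entropy of the parsing is at most the cost of encoding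
  each phrase \<open>y\<close> after its predecessor \<open>x\<close> under any conditional subprobability \<open>q x y\<close>.
  Choose \<open>q x y\<close> as the empirical probability of the length of \<open>y\<close> times the product of the
  empirical order-\<open>k\<close> probabilities of the letters of \<open>y\<close>; as \<open>x\<close> has at least \<open>k\<close> letters, the
  contexts of all these letters are determined by \<open>x @ y\<close>. The total cost splits into the entropy
  of the lengths and the order-\<open>k\<close> cost of the letters outside the first phrase.

  For the asymptotic bound, let \<open>t\<close> be the number of phrases, \<open>n\<close> the length of the string and
  \<open>m = n / log\<^sub>\<sigma> n\<close>. Gibbs' inequality with weights \<open>1 / (l (l + 1))\<close> bounds the entropy of the
  lengths by \<open>t + 2 t log (n / t)\<close>, and \<open>t log (n / t) = t log (m / t) + t log (log\<^sub>\<sigma> n)\<close>, where the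
  first term is \<open>O(m)\<close> and the second is \<open>O(m log log n)\<close>.
\<close>

section \<open>Empirical frequencies and Gibbs' inequality\<close>

definition freq :: "'a list \<Rightarrow> 'a \<Rightarrow> real" where
  "freq T a = real (count_list T a) / real (length T)"

lemma freq_nonneg: "0 \<le> freq T a"
  by (simp add: freq_def)

lemma freq_le_1: "freq T a \<le> 1"
  by (simp add: freq_def divide_le_eq_1 count_le_length)

lemma freq_pos: "a \<in> set T \<Longrightarrow> 0 < freq T a"
  using count_list_0_iff[of T a] length_pos_if_in_set[of a T] by (simp add: freq_def)

text \<open>Only an inequality, because division by zero makes all frequencies in an empty string 0;
  a context that never occurs thus still yields a subprobability.\<close>

lemma sum_freq_le_1:
  assumes "finite A"
  shows "(\<Sum>a\<in>A. freq T a) \<le> 1"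
proof -
  have "(\<Sum>a\<in>A. freq T a) = (\<Sum>a\<in>A \<inter> set T. freq T a)"
    using assms by (intro sum.mono_neutral_right) (auto simp: freq_def)
  also have "\<dots> \<le> (\<Sum>a\<in>set T. freq T a)"
    by (intro sum_mono2) (auto simp: freq_nonneg)
  also have "\<dots> = real (\<Sum>a\<in>set T. count_list T a) / real (length T)"
    by (simp add: freq_def sum_divide_distrib)
  also have "\<dots> \<le> 1"
    by (simp add: sum_count_set)
  finally show ?thesis .
qed

lemma sum_list_eq_sum_count:
  fixes f :: "'a \<Rightarrow> real"
  shows "(\<Sum>x\<leftarrow>T. f x) = (\<Sum>a\<in>set T. real (count_list T a) * f a)"
proof -
  \<comment> \<open>The range \<open>A\<close> stays fixed during the induction, whereas
    \<open>set T\<close> would grow.\<close>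
  have *: "(\<Sum>x\<leftarrow>T. f x) = (\<Sum>a\<in>A. real (count_list T a) * f a)"
    if "finite A" "set T \<subseteq> A" for A
    using that
  proof (induction T)
    case (Cons b T)
    have "(\<Sum>a\<in>A. real (count_list (b # T) a) * f a)
        = (\<Sum>a\<in>A. (if b = a then f a else 0) + real (count_list T a) * f a)"
      by (intro sum.cong) (auto simp: algebra_simps)
    then show ?case
      using Cons by (simp add: sum.distrib)
  qed simp
  show ?thesis by (rule *) auto
qed

text \<open>The additive form, an ideal code length charged letter by letter, in which costs are
  compared below.\<close>

lemma length_times_entropy0:
  "real (length T) * entropy0 T = (\<Sum>x\<leftarrow>T. - log 2 (freq T x))"
  by (cases "T = []") (auto simp: sum_list_eq_sum_count entropy0_def freq_def sum_distrib_left sum_negf)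

text \<open>Apply \<open>ln z \<le> z - 1\<close> at \<open>z = q a / freq T a\<close> and weight by
  the counts: the bounds add up to a nonnegative multiple of the total of \<open>q\<close> minus
  1.\<close>

lemma gibbs:
  assumes pos: "\<And>a. a \<in> set T \<Longrightarrow> 0 < q a" and le1: "(\<Sum>a\<in>set T. q a) \<le> 1"
  shows "real (length T) * entropy0 T \<le> (\<Sum>x\<leftarrow>T. - log 2 (q x))"
proof (cases "T = []")
  case False
  let ?N = "real (length T)" and ?c = "\<lambda>a. real (count_list T a)"
  have N: "?N > 0" using False by simp
  have step: "?c a * log 2 (q a) - ?c a * log 2 (freq T a) \<le> (?N * q a - ?c a) / ln 2"
    if "a \<in> set T" for a
  proof -
    have c: "?c a > 0" using that by (metis count_list_0_iff of_nat_0_less_iff neq0_conv)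
    have "ln (q a / freq T a) \<le> q a / freq T a - 1"
      using pos[OF that] freq_pos[OF that] by (intro ln_le_minus_one) auto
    then have "?c a * (ln (q a) - ln (freq T a)) \<le> ?c a * (q a / freq T a - 1)"
      using c pos[OF that] freq_pos[OF that] by (intro mult_left_mono) (auto simp: ln_div)
    also have "\<dots> = ?N * q a - ?c a"
      using c N by (simp add: freq_def field_simps)
    finally have "?c a * (ln (q a) - ln (freq T a)) / ln 2 \<le> (?N * q a - ?c a) / ln 2"
      by (intro divide_right_mono) auto
    then show ?thesis
      by (simp add: log_def right_diff_distrib diff_divide_distrib)
  qed
  have "(\<Sum>x\<leftarrow>T. - log 2 (freq T x)) - (\<Sum>x\<leftarrow>T. - log 2 (q x))
      = (\<Sum>a\<in>set T. ?c a * log 2 (q a) - ?c a * log 2 (freq T a))"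
    by (simp add: sum_list_eq_sum_count sum_subtractf sum_negf)
  also have "\<dots> \<le> (\<Sum>a\<in>set T. (?N * q a - ?c a) / ln 2)"
    by (intro sum_mono step)
  also have "\<dots> = (?N * (\<Sum>a\<in>set T. q a) - real (\<Sum>a\<in>set T. count_list T a)) / ln 2"
    by (simp add: sum_subtractf sum_distrib_left flip: sum_divide_distrib)
  also have "\<dots> = ?N * ((\<Sum>a\<in>set T. q a) - 1) / ln 2"
    by (simp add: sum_count_set algebra_simps)
  also have "\<dots> \<le> 0"
    using le1 by (intro divide_nonpos_pos mult_nonneg_nonpos) auto
  finally show ?thesis by (simp add: length_times_entropy0)
qed simp

section \<open>Order-\<open>k\<close> entropy as a sum over positions\<close>

text \<open>The letters preceding position \<open>i\<close> once \<open>k \<le> i\<close>; for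
  smaller \<open>i\<close>, truncated subtraction gives a prefix of \<open>T\<close>
  instead.\<close>

definition context_at :: "nat \<Rightarrow> 'a list \<Rightarrow> nat \<Rightarrow> 'a list" where
  "context_at k T i = take k (drop (i - k) T)"

text \<open>Each position from \<open>k\<close> on has exactly one context, so the strings
  \<open>following w T\<close> partition these positions.\<close>

lemma sum_following:
  fixes f :: "'a list \<Rightarrow> 'a \<Rightarrow> real"
  assumes "finite \<Gamma>" "set T \<subseteq> \<Gamma>"
  shows "(\<Sum>w\<in>{w. set w \<subseteq> \<Gamma> \<and> length w = k}. \<Sum>x\<leftarrow>following w T. f w x)
       = (\<Sum>i\<in>{k..<length T}. f (context_at k T i) (T ! i))"
proof -
  let ?W = "{w. set w \<subseteq> \<Gamma> \<and> length w = k}"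
  have "(\<Sum>w\<in>?W. \<Sum>x\<leftarrow>following w T. f w x)
      = (\<Sum>w\<in>?W. \<Sum>i\<in>{i \<in> {k..<length T}. context_at k T i = w}. f (context_at k T i) (T ! i))"
  proof (rule sum.cong)
    fix w assume "w \<in> ?W"
    then show "(\<Sum>x\<leftarrow>following w T. f w x)
      = (\<Sum>i\<in>{i \<in> {k..<length T}. context_at k T i = w}. f (context_at k T i) (T ! i))"
      by (auto simp: following_def context_at_def o_def sum_list_distinct_conv_sum_set
          simp flip: set_upt intro!: sum.cong)
  qed simp
  also have "\<dots> = (\<Sum>i\<in>{k..<length T}. f (context_at k T i) (T ! i))"
  proof (rule sum.group)
    show "finite ?W" using assms finite_lists_length_eq by blast
    show "context_at k T ` {k..<length T} \<subseteq> ?W"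
      using assms(2) by (auto simp: context_at_def dest!: in_set_takeD in_set_dropD)
  qed simp
  finally show ?thesis .
qed

lemma following_Nil: "following [] T = T"
  by (simp add: following_def map_nth)

text \<open>For \<open>k = 0\<close> the only context is \<open>[]\<close>, and
  \<open>following [] T = T\<close>, so the special case of the definition fits the general
  sum.\<close>

lemma length_times_entropy:
  "real (length T) * entropy \<Gamma> k T
     = (\<Sum>w\<in>{w. set w \<subseteq> \<Gamma> \<and> length w = k}.
          real (length (following w T)) * entropy0 (following w T))"
proof (cases "k = 0")
  case True
  then have "{w. set w \<subseteq> \<Gamma> \<and> length w = k} = {[]}" by auto
  then show ?thesis using True by (simp add: entropy_def following_Nil)
next
  case False
  then show ?thesis
    by (cases "T = []") (auto simp: entropy_def following_def)
qed

lemma length_times_entropy_positions: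
  assumes "finite \<Gamma>" "set T \<subseteq> \<Gamma>"
  shows "real (length T) * entropy \<Gamma> k T
       = (\<Sum>i\<in>{k..<length T}. - log 2 (freq (following (context_at k T i) T) (T ! i)))"
  unfolding length_times_entropy length_times_entropy0
  using sum_following[OF assms, where f = "\<lambda>w a. - log 2 (freq (following w T) a)"] .

text \<open>Gibbs' inequality is applied in each context on its own, so \<open>q w\<close> has to be
  a subprobability for every single \<open>w\<close>.\<close>

lemma gibbs_conditional:
  assumes "finite \<Gamma>" "set T \<subseteq> \<Gamma>"
    and "\<And>w a. length w = k \<Longrightarrow> a \<in> set (following w T) \<Longrightarrow> 0 < q w a"
    and "\<And>w. (\<Sum>a\<in>set (following w T). q w a) \<le> 1"
  shows "real (length T) * entropy \<Gamma> k T
       \<le> (\<Sum>i\<in>{k..<length T}. - log 2 (q (context_at k T i) (T ! i)))"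
  unfolding length_times_entropy
    sum_following[OF assms(1,2), where f = "\<lambda>w a. - log 2 (q w a)", symmetric]
  by (intro sum_mono gibbs assms(3,4)) auto

lemma nth_in_following:
  assumes "k \<le> i" "i < length T"
  shows "T ! i \<in> set (following (context_at k T i) T)"
  using assms by (force simp: following_def context_at_def)

lemma in_set_following_singleton:
  assumes "y \<in> set (following [x] Y)"
  obtains i where "Suc i < length Y" "Y ! i = x" "Y ! Suc i = y"
proof -
  from assms obtain j where j: "1 \<le> j" "j < length Y" "take 1 (drop (j - 1) Y) = [x]" "Y ! j = y"
    by (auto simp: following_def)
  then obtain i where "j = Suc i" by (cases j) auto
  with j have "Suc i < length Y" "Y ! i = x" "Y ! Suc i = y"
    by (auto simp: take_Suc hd_drop_conv_nth)
  then show thesis by (rule that)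
qed

section \<open>Chain rule for the probability of a phrase\<close>

text \<open>
  \<open>cond_prob k p x y\<close> is the probability of writing \<open>y\<close> after \<open>x\<close> when each letter \<open>a\<close> is drawn with
  probability \<open>p w a\<close>, for \<open>w\<close> the \<open>k\<close> letters preceding it.
\<close>

fun cond_prob :: "nat \<Rightarrow> ('a list \<Rightarrow> 'a \<Rightarrow> real) \<Rightarrow> 'a list \<Rightarrow> 'a list \<Rightarrow> real" where
  "cond_prob k p x [] = 1"
| "cond_prob k p x (a # y) = p (drop (length x - k) x) a * cond_prob k p (x @ [a]) y"

lemma cond_prob_nonneg:
  assumes "\<And>w a. 0 \<le> p w a"
  shows "0 \<le> cond_prob k p x y"
  using assms by (induction y arbitrary: x) auto

text \<open>Split off the first letter \<open>a\<close>; the remaining letters sum to at most 1 by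
  induction with the history \<open>x @ [a]\<close>. The length is fixed because different lengths
  together can exceed 1.\<close>

lemma sum_cond_prob_le_1:
  assumes "finite \<Gamma>" and nonneg: "\<And>w a. 0 \<le> p w a" and le1: "\<And>w. (\<Sum>a\<in>\<Gamma>. p w a) \<le> 1"
  shows "(\<Sum>y\<in>{y. set y \<subseteq> \<Gamma> \<and> length y = l}. cond_prob k p x y) \<le> 1"
proof (induction l arbitrary: x)
  case 0
  have "{y. set y \<subseteq> \<Gamma> \<and> length y = 0} = {[]}" by auto
  then show ?case by simp
next
  case (Suc l)
  let ?Z = "\<lambda>l. {y. set y \<subseteq> \<Gamma> \<and> length y = l}"
  have eq: "?Z (Suc l) = (\<lambda>(a, y). a # y) ` (\<Gamma> \<times> ?Z l)"
    by (auto simp: length_Suc_conv image_iff)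
  have "(\<Sum>y\<in>?Z (Suc l). cond_prob k p x y)
      = (\<Sum>(a, y)\<in>\<Gamma> \<times> ?Z l. p (drop (length x - k) x) a * cond_prob k p (x @ [a]) y)"
    unfolding eq by (subst sum.reindex) (auto simp: inj_on_def intro!: sum.cong)
  also have "\<dots> = (\<Sum>a\<in>\<Gamma>. p (drop (length x - k) x) a * (\<Sum>y\<in>?Z l. cond_prob k p (x @ [a]) y))"
    by (simp add: sum_distrib_left sum.cartesian_product)
  also have "\<dots> \<le> (\<Sum>a\<in>\<Gamma>. p (drop (length x - k) x) a * 1)"
    by (intro sum_mono mult_left_mono Suc.IH nonneg)
  also have "\<dots> \<le> 1" using le1 by simp
  finally show ?case .
qed

text \<open>As \<open>x\<close> has at least \<open>k\<close> letters, the windows before the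
  letters of \<open>y\<close> never reach into \<open>A\<close>, so \<open>cond_prob\<close> sees
  the same contexts as \<open>S\<close>.\<close>

lemma cond_prob_factor:
  assumes "k \<le> length x" "S = A @ x @ y @ B"
    and "\<And>i. k \<le> i \<Longrightarrow> i < length S \<Longrightarrow> 0 < p (context_at k S i) (S ! i)"
  shows "0 < cond_prob k p x y \<and> log 2 (cond_prob k p x y)
       = (\<Sum>j<length y. log 2 (p (context_at k S (length (A @ x) + j)) (S ! (length (A @ x) + j))))"
  using assms
proof (induction y arbitrary: x)
  case (Cons a y)
  let ?o = "length (A @ x)"
  let ?f = "\<lambda>j. log 2 (p (context_at k S (?o + j)) (S ! (?o + j)))"
  \<comment> \<open>The first letter of \<open>y\<close> moves to the end of \<open>x\<close>, while
    \<open>A\<close> and \<open>B\<close> stay fixed.\<close>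
  have S: "S = A @ (x @ [a]) @ y @ B" using Cons.prems by simp
  have IH: "0 < cond_prob k p (x @ [a]) y \<and>
      log 2 (cond_prob k p (x @ [a]) y) = (\<Sum>j<length y. ?f (Suc j))"
    using Cons.IH[OF _ S Cons.prems(3)] Cons.prems(1) by simp
  have ctx: "context_at k S ?o = drop (length x - k) x"
    using Cons.prems(1,2) by (simp add: context_at_def)
  have a: "S ! ?o = a" using Cons.prems(2) by (simp add: nth_append)
  have pos: "0 < p (drop (length x - k) x) a"
    using Cons.prems(3)[of ?o] Cons.prems(1,2) unfolding ctx a by simp
  have "log 2 (cond_prob k p x (a # y)) = ?f 0 + (\<Sum>j<length y. ?f (Suc j))"
    using pos IH ctx a by (simp add: log_mult)
  then show ?case
    using pos IH by (simp only: list.size add_0_right sum.lessThan_Suc_shift add_Suc_right) simp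
qed simp

section \<open>First-order entropy of a parsing\<close>

text \<open>Appending a phrase leaves the offsets of the earlier phrases unchanged, hence the
  induction from the right.\<close>

lemma sum_concat_positions:
  fixes h :: "nat \<Rightarrow> real"
  shows "(\<Sum>i<length Y. \<Sum>j<length (Y ! i). h (length (concat (take i Y)) + j))
       = (\<Sum>i<length (concat Y). h i)"
proof (induction Y rule: rev_induct)
  case (snoc y Y)
  have "(\<Sum>i<m + l. h i) = (\<Sum>i<m. h i) + (\<Sum>j<l. h (m + j))" for m l
    by (induction l) (auto simp: add.assoc)
  then show ?case using snoc by (simp add: nth_append)
qed simp

lemma entropy_parsing_le:
  assumes fin: "finite \<Gamma>" and sub: "set S \<subseteq> \<Gamma>" and par: "parsing Y S"
    and long: "\<And>y. y \<in> set Y \<Longrightarrow> k \<le> length y"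
  shows "real (length Y) * entropy (set Y) 1 Y
       \<le> real (length S) * entropy \<Gamma> k S + real (length Y) * entropy0 (map length Y)"
proof -
  let ?L = "map length Y"
  define p where "p w = freq (following w S)" for w
  \<comment> \<open>Contexts in \<open>Y\<close> are singletons \<open>[x]\<close>, so
    \<open>hd w\<close> is the preceding phrase.\<close>
  define q where "q w y = freq ?L (length y) * cond_prob k p (hd w) y" for w y
  \<comment> \<open>The cost of the letter at position \<open>i\<close>; the first \<open>k\<close>
    positions have no full context and do not count in the order-\<open>k\<close> entropy.\<close>
  define h where "h i = (if i < k then 0 else - log 2 (p (context_at k S i) (S ! i)))" for i
  have S: "S = concat Y" using par by (simp add: parsing_def)
  have p_pos: "0 < p (context_at k S i) (S ! i)" if "k \<le> i" "i < length S" for i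
    using that unfolding p_def by (intro freq_pos nth_in_following)
  have h_nonneg: "0 \<le> h i" if "i < length S" for i
    using that p_pos[of i] by (auto simp: h_def p_def freq_le_1)
  have factor: "0 < cond_prob k p (Y ! i) (Y ! Suc i) \<and> - log 2 (cond_prob k p (Y ! i) (Y ! Suc i))
      = (\<Sum>j<length (Y ! Suc i). h (length (concat (take (Suc i) Y)) + j))"
    if i: "Suc i < length Y" for i
  proof -
    let ?x = "Y ! i" and ?y = "Y ! Suc i" and ?A = "concat (take i Y)"
    have "Y = take i Y @ ?x # ?y # drop (Suc (Suc i)) Y"
      using i by (metis Cons_nth_drop_Suc Suc_lessD append_take_drop_id)
    then have S': "S = ?A @ ?x @ ?y @ concat (drop (Suc (Suc i)) Y)"
      unfolding S by (metis concat.simps(2) concat_append)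
    have kx: "k \<le> length ?x" using i by (intro long) auto
    have o: "length (?A @ ?x) = length (concat (take (Suc i) Y))"
      using i by (simp add: take_Suc_conv_app_nth)
    \<comment> \<open>The position is at least \<open>length ?x\<close>, hence at least
      \<open>k\<close>, so the default 0 of \<open>h\<close> does not occur.\<close>
    have "h (length (?A @ ?x) + j) = - log 2 (p (context_at k S (length (?A @ ?x) + j))
            (S ! (length (?A @ ?x) + j)))" for j
      using kx by (simp add: h_def)
    then show ?thesis
      using cond_prob_factor[OF kx S', of p] p_pos unfolding o by (simp add: sum_negf)
  qed
  have q_pos: "0 < q w y" if w1: "length w = 1" and y: "y \<in> set (following w Y)" for w y
  proof -
    obtain x where w: "w = [x]" using w1 by (auto simp: length_Suc_conv)
    obtain i where i: "Suc i < length Y" "Y ! i = x" "Y ! Suc i = y"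
      using y in_set_following_singleton unfolding w by metis
    then have "length y \<in> set ?L" by (auto intro!: nth_mem)
    then show ?thesis
      using factor[OF i(1)] i freq_pos[of "length y" ?L] by (simp add: q_def w)
  qed
  have q_le1: "(\<Sum>y\<in>set (following w Y). q w y) \<le> 1" for w
  proof -
    let ?Z = "\<lambda>l. {y. set y \<subseteq> set S \<and> length y = l}"
    have subY: "set (following w Y) \<subseteq> set Y"
      by (auto simp: following_def)
    have finZ: "finite (?Z l)" for l using finite_lists_length_eq[of "set S" l] by simp
    have nonneg: "0 \<le> cond_prob k p (hd w) y" for y
      by (intro cond_prob_nonneg) (simp add: p_def freq_nonneg)
    \<comment> \<open>Group by length: within one length the conditional probabilities sum to at
      most 1, and so do the length frequencies.\<close>
    have "(\<Sum>y\<in>set (following w Y). q w y)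
        = (\<Sum>l\<in>set ?L. \<Sum>y\<in>{y \<in> set (following w Y). length y = l}. q w y)"
      using subY by (intro sum.group[symmetric]) auto
    also have "\<dots> \<le> (\<Sum>l\<in>set ?L. \<Sum>y\<in>?Z l. q w y)"
    proof (intro sum_mono sum_mono2 finZ)
      show "{y \<in> set (following w Y). length y = l} \<subseteq> ?Z l" for l
        using subY by (auto simp: S)
    qed (simp add: q_def nonneg freq_nonneg)
    also have "\<dots> = (\<Sum>l\<in>set ?L. freq ?L l * (\<Sum>y\<in>?Z l. cond_prob k p (hd w) y))"
      by (simp add: q_def sum_distrib_left)
    also have "\<dots> \<le> (\<Sum>l\<in>set ?L. freq ?L l * 1)"
      by (intro sum_mono mult_left_mono sum_cond_prob_le_1)
        (simp_all add: p_def freq_nonneg sum_freq_le_1)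
    also have "\<dots> \<le> 1" by (simp add: sum_freq_le_1)
    finally show ?thesis .
  qed
  have "real (length Y) * entropy (set Y) 1 Y
      \<le> (\<Sum>i\<in>{1..<length Y}. - log 2 (q (context_at 1 Y i) (Y ! i)))"
    by (rule gibbs_conditional) (auto intro: q_pos q_le1)
  also have "\<dots> = (\<Sum>i\<in>{1..<length Y}. - log 2 (freq ?L (?L ! i))
      + (\<Sum>j<length (Y ! i). h (length (concat (take i Y)) + j)))"
  proof (rule sum.cong)
    fix i' assume i': "i' \<in> {1..<length Y}"
    then obtain i where i: "i' = Suc i" "Suc i < length Y" by (cases i') auto
    have "length (Y ! i') \<in> set ?L" using i by (auto intro!: nth_mem)
    then show "- log 2 (q (context_at 1 Y i') (Y ! i')) = - log 2 (freq ?L (?L ! i'))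
      + (\<Sum>j<length (Y ! i'). h (length (concat (take i' Y)) + j))"
      using factor[OF i(2)] i freq_pos[of "length (Y ! i')" ?L]
      by (simp add: q_def context_at_def take_Suc hd_drop_conv_nth log_mult)
  qed simp
  \<comment> \<open>The first phrase has no predecessor and was not charged. Its cost is
    nonnegative, as the probabilities involved are at most 1, and adding it completes both
    sums.\<close>
  also have "\<dots> \<le> (\<Sum>i<length Y. - log 2 (freq ?L (?L ! i))
      + (\<Sum>j<length (Y ! i). h (length (concat (take i Y)) + j)))"
  proof (rule sum_mono2)
    fix i assume "i \<in> {..<length Y} - {1..<length Y}"
    then have i: "i < length Y" by simp
    have "length (concat (take i Y)) + j < length S" if "j < length (Y ! i)" for j
    proof -
      have "concat Y = concat (take i Y) @ Y ! i @ concat (drop (Suc i) Y)"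
        using i by (metis concat.simps(2) concat_append id_take_nth_drop)
      then have "length S = length (concat (take i Y)) + length (Y ! i) + length (concat (drop (Suc i) Y))"
        unfolding S by (metis length_append add.assoc)
      then show ?thesis using that by linarith
    qed
    moreover have "0 < freq ?L (?L ! i)" using i by (intro freq_pos nth_mem) simp
    then have "0 \<le> - log 2 (freq ?L (?L ! i))" by (simp add: freq_le_1)
    ultimately show "0 \<le> - log 2 (freq ?L (?L ! i))
      + (\<Sum>j<length (Y ! i). h (length (concat (take i Y)) + j))"
      by (intro add_nonneg_nonneg sum_nonneg h_nonneg) auto
  qed auto
  also have "\<dots> = (\<Sum>i<length ?L. - log 2 (freq ?L (?L ! i))) + (\<Sum>i<length S. h i)"
    unfolding sum.distrib sum_concat_positions S by simp
  also have "(\<Sum>i<length ?L. - log 2 (freq ?L (?L ! i))) = real (length ?L) * entropy0 ?L"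
    unfolding length_times_entropy0 by (simp add: sum_list_sum_nth atLeast0LessThan)
  also have "(\<Sum>i<length S. h i) = (\<Sum>i\<in>{k..<length S}. h i)"
    by (rule sum.mono_neutral_right) (auto simp: h_def)
  also have "\<dots> = real (length S) * entropy \<Gamma> k S"
    unfolding length_times_entropy_positions[OF fin sub] by (rule sum.cong) (auto simp: h_def p_def)
  finally show ?thesis by simp
qed

section \<open>Entropy of the phrase lengths and its asymptotics\<close>

text \<open>The sum telescopes; it makes these weights a subprobability on lengths.\<close>

lemma sum_inverse_consecutive_le_1:
  assumes "finite A" "0 \<notin> A"
  shows "(\<Sum>l\<in>A. 1 / (real l * real (l + 1))) \<le> 1"
proof -
  obtain m where m: "A \<subseteq> {1..m}"
    using assms by (metis Max_ge atLeastAtMost_iff less_one not_le subsetI)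
  have "(\<Sum>l\<in>A. 1 / (real l * real (l + 1))) \<le> (\<Sum>l\<in>{1..m}. 1 / (real l * real (l + 1)))"
    using m by (intro sum_mono2) auto
  also have "\<dots> = 1 - 1 / real (m + 1)"
  proof (induction m)
    case (Suc m)
    have "1 - 1 / real (m + 1) + 1 / (real (Suc m) * real (Suc m + 1)) = 1 - 1 / real (Suc m + 1)"
      by (simp add: divide_simps) (simp add: algebra_simps)
    with Suc show ?case by simp
  qed simp
  also have "\<dots> \<le> 1" by simp
  finally show ?thesis .
qed

lemma entropy0_positive_le:
  assumes "L \<noteq> []" "0 \<notin> set L"
  shows "real (length L) * entropy0 L
       \<le> real (length L) + 2 * (real (length L) * log 2 (real (sum_list L) / real (length L)))"
proof -
  let ?t = "real (length L)" and ?n = "real (sum_list L)"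
  let ?\<mu> = "?n / ?t"
  have t: "?t > 0" using assms(1) by simp
  have n: "?n > 0"
  proof -
    have "sum_list L \<noteq> 0"
      using assms by (cases L) auto
    then show ?thesis by linarith
  qed
  have \<mu>: "?\<mu> > 0" using t n by simp
  \<comment> \<open>Use \<open>l + 1 \<le> 2 * l\<close>, then bound the concave
    \<open>log 2 l\<close> by its tangent at the mean \<open>?\<mu>\<close>; the linear corrections
    cancel when summed over \<open>L\<close>.\<close>
  have step: "- log 2 (1 / (real l * real (l + 1))) \<le> 1 + 2 * (log 2 ?\<mu> + (real l / ?\<mu> - 1) / ln 2)"
    if "l \<in> set L" for l
  proof -
    have "l \<noteq> 0" using that assms(2) by metis
    then have l: "real l \<ge> 1" by simp
    have "- log 2 (1 / (real l * real (l + 1))) = log 2 (real l * real (l + 1))"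
      using l by (simp add: log_divide)
    also have "\<dots> \<le> log 2 (real l * (2 * real l))"
      using l by (intro log_mono mult_left_mono mult_pos_pos) auto
    also have "\<dots> = 1 + 2 * log 2 (real l)"
      using l by (simp add: log_mult)
    also have "log 2 (real l) = log 2 ?\<mu> + ln (real l / ?\<mu>) / ln 2"
    proof -
      have "ln (real l / ?\<mu>) = ln (real l) - ln ?\<mu>"
        by (rule ln_divide_pos) (use l \<mu> in linarith)+
      then show ?thesis by (simp only: log_def diff_divide_distrib)
    qed
    also have "ln (real l / ?\<mu>) \<le> real l / ?\<mu> - 1"
      using l \<mu> by (intro ln_le_minus_one divide_pos_pos[of "real l"]) linarith+
    finally show ?thesis by (simp add: divide_right_mono)
  qed
  have "?t * entropy0 L \<le> (\<Sum>l\<leftarrow>L. - log 2 (1 / (real l * real (l + 1))))"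
  proof (rule gibbs)
    show "0 < 1 / (real l * real (l + 1))" if "l \<in> set L" for l
    proof -
      have "l \<noteq> 0" using that assms(2) by metis
      then show ?thesis by simp
    qed
  qed (intro sum_inverse_consecutive_le_1 finite_set assms(2))
  also have "\<dots> \<le> (\<Sum>l\<leftarrow>L. 1 + 2 * (log 2 ?\<mu> + (real l / ?\<mu> - 1) / ln 2))"
    by (intro sum_list_mono step)
  also have "\<dots> = ?t + 2 * (?t * log 2 ?\<mu> + (?n / ?\<mu> - ?t) / ln 2)"
  proof -
    have "(\<Sum>l\<leftarrow>M. 1 + 2 * (c + (real l / d - 1) / ln 2))
        = real (length M) + 2 * (real (length M) * c + (real (sum_list M) / d - real (length M)) / ln 2)"
      for c d :: real and M :: "nat list"
      by (induction M) (auto simp: algebra_simps add_divide_distrib diff_divide_distrib)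
    then show ?thesis .
  qed
  also have "?n / ?\<mu> = ?t" using less_imp_neq[OF n] by simp
  finally show ?thesis by simp
qed

text \<open>In the constant, \<open>C\<close> comes from the bound on the number \<open>t\<close> of
  phrases, \<open>4\<close> from \<open>2 * t * log 2 (m / t)\<close> and \<open>2 * C\<close> from
  \<open>2 * t * log 2 (log s n)\<close>.\<close>

lemma parsing_lengths_entropy_le:
  fixes m n s :: real
  assumes par: "parsing Y S" and n: "n = real (length S)" and m: "m = n / log s n"
    and "4 \<le> n" "2 \<le> s" "real (length Y) \<le> C * m" "0 \<le> C"
  shows "real (length Y) * entropy0 (map length Y) \<le> (3 * C + 4) * (m * log 2 (log 2 n))"
proof -
  let ?t = "real (length Y)" and ?L = "map length Y" and ?LL = "log 2 (log 2 n)"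
  have ls: "0 < log s n" using \<open>4 \<le> n\<close> \<open>2 \<le> s\<close> by simp
  have m0: "0 < m" unfolding m using ls \<open>4 \<le> n\<close> by (intro divide_pos_pos) auto
  \<comment> \<open>From \<open>4 \<le> n\<close> the double logarithm is at least 1, so it can
    absorb the terms linear in \<open>m\<close>.\<close>
  have "log 2 4 \<le> log 2 n" using assms by (intro log_mono) auto
  moreover have "log 2 4 = (2::real)" using log_pow_cancel[of "2::real" 2] by simp
  ultimately have log2: "2 \<le> log 2 n" by simp
  then have "log 2 2 \<le> ?LL" by (intro log_mono) auto
  then have LL: "1 \<le> ?LL" by simp
  show ?thesis
  proof (cases "Y = []")
    case True
    then show ?thesis using m0 LL \<open>0 \<le> C\<close> by simp
  next
    case False
    then have t: "?t > 0" by simp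
    have "0 \<notin> set ?L" using par by (auto simp: parsing_def)
    moreover have "sum_list ?L = length S"
      using par by (auto simp: parsing_def length_concat)
    ultimately have "?t * entropy0 ?L \<le> ?t + 2 * (?t * log 2 (n / ?t))"
      using entropy0_positive_le[of ?L] False n by simp
    also have "n / ?t = (m / ?t) * log s n"
      using m ls by simp
    also have "log 2 ((m / ?t) * log s n) = log 2 (m / ?t) + log 2 (log s n)"
      using m0 t ls by (subst log_mult) auto
    also have "?t * (log 2 (m / ?t) + log 2 (log s n)) \<le> 2 * m + C * m * ?LL"
    proof -
      have "ln (m / ?t) \<le> m / ?t - 1"
        using m0 t by (intro ln_le_minus_one) auto
      then have "?t * log 2 (m / ?t) \<le> ?t * ((m / ?t - 1) / ln 2)"
        unfolding log_def by (intro mult_left_mono divide_right_mono) auto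
      also have "\<dots> = (m - ?t) / ln 2"
        using t by (simp add: field_simps)
      also have "\<dots> \<le> m / ln 2"
        using t by (intro divide_right_mono) auto
      \<comment> \<open>Here \<open>ln 2 \<ge> 1 / 2\<close>, by \<open>ln z \<le> z - 1\<close> at
        \<open>z = 1 / 2\<close>.\<close>
      also have "\<dots> \<le> m / (1 / 2)"
        using m0 ln_le_minus_one[of "1 / 2"] by (intro divide_left_mono) (auto simp: ln_div)
      finally have 1: "?t * log 2 (m / ?t) \<le> 2 * m" by simp
      have "log s n \<le> log 2 n"
        unfolding log_def using assms by (intro divide_left_mono) auto
      then have "log 2 (log s n) \<le> ?LL"
        using ls by (intro log_mono) auto
      then have "?t * log 2 (log s n) \<le> ?t * ?LL"
        by (intro mult_left_mono) auto
      also have "\<dots> \<le> C * m * ?LL"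
        using assms LL by (intro mult_right_mono) auto
      finally show ?thesis using 1 by (simp add: distrib_left)
    qed
    finally have "?t * entropy0 ?L \<le> ?t + 2 * (2 * m + C * m * ?LL)" by simp
    also have "\<dots> \<le> (C + 4) * m * 1 + 2 * (C * m * ?LL)"
      using \<open>real (length Y) \<le> C * m\<close> by (simp only: distrib_left distrib_right)
    also have "\<dots> \<le> (C + 4) * m * ?LL + 2 * (C * m * ?LL)"
      using LL m0 \<open>0 \<le> C\<close> by (intro add_right_mono mult_left_mono) auto
    finally show ?thesis by (simp add: algebra_simps)
  qed
qed

lemma entropy0_nonneg: "0 \<le> entropy0 T"
proof (cases "T = []")
  case False
  have "0 \<le> real (length T) * entropy0 T"
    unfolding length_times_entropy0
    by (intro sum_list_nonneg) (auto simp: freq_pos freq_le_1)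
  then show ?thesis using False by (simp add: zero_le_mult_iff)
qed (simp add: entropy0_def)

text \<open>The alphabets may vary with \<open>i\<close>: the constant of the pointwise bound
  depends only on \<open>C\<close>, not on the alphabet size.\<close>

lemma parsing_lengths_entropy_bigo:
  fixes \<Gamma> :: "'i \<Rightarrow> 'a set" and S :: "'i \<Rightarrow> 'a list" and Y :: "'i \<Rightarrow> 'a list list"
  assumes alph: "\<And>i. 2 \<le> card (\<Gamma> i)" and par: "\<And>i. parsing (Y i) (S i)"
    and long: "filterlim (\<lambda>i. length (S i)) at_top F"
    and few: "(\<lambda>i. real (length (Y i)))
      \<in> O[F](\<lambda>i. real (length (S i)) / log (real (card (\<Gamma> i))) (real (length (S i))))"
  shows "(\<lambda>i. real (length (Y i)) * entropy0 (map length (Y i)))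
      \<in> O[F](\<lambda>i. real (length (S i)) * log 2 (log 2 (real (length (S i))))
                    / log (real (card (\<Gamma> i))) (real (length (S i))))"
proof -
  let ?m = "\<lambda>i. real (length (S i)) / log (real (card (\<Gamma> i))) (real (length (S i)))"
  obtain C where C: "C > 0" and ev: "eventually (\<lambda>i. norm (real (length (Y i))) \<le> C * norm (?m i)) F"
    using few by (elim landau_o.bigE)
  have ev4: "eventually (\<lambda>i. 4 \<le> length (S i)) F"
    using long by (simp add: filterlim_at_top)
  show ?thesis
  proof (rule landau_o.bigI)
    show "3 * C + 4 > 0" using C by simp
    show "eventually (\<lambda>i. norm (real (length (Y i)) * entropy0 (map length (Y i)))
      \<le> (3 * C + 4) * norm (real (length (S i)) * log 2 (log 2 (real (length (S i))))
                    / log (real (card (\<Gamma> i))) (real (length (S i))))) F"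
      using ev ev4
    proof eventually_elim
      case (elim i)
      have "0 \<le> log (real (card (\<Gamma> i))) (real (length (S i)))"
        using elim(2) alph[of i] by (subst zero_le_log_cancel_iff) linarith+
      then have m: "0 \<le> ?m i" by (intro divide_nonneg_nonneg) auto
      have t: "real (length (Y i)) \<le> C * ?m i"
        using elim(1) unfolding real_norm_def abs_of_nonneg[OF m] by simp
      have "real (length (Y i)) * entropy0 (map length (Y i))
          \<le> (3 * C + 4) * (?m i * log 2 (log 2 (real (length (S i)))))"
        using elim(2) C alph[of i]
        by (intro parsing_lengths_entropy_le[OF par refl refl _ _ t]) auto
      also have "\<dots> = (3 * C + 4) * (real (length (S i)) * log 2 (log 2 (real (length (S i))))
                    / log (real (card (\<Gamma> i))) (real (length (S i))))"
        by simp
      also have "\<dots> \<le> (3 * C + 4) * norm (real (length (S i)) * log 2 (log 2 (real (length (S i))))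
                    / log (real (card (\<Gamma> i))) (real (length (S i))))"
        unfolding real_norm_def using C by (intro mult_left_mono abs_ge_self) simp
      finally show ?case by (simp add: entropy0_nonneg)
    qed
  qed
qed

theorem theorem3:
  shows
    "(\<forall>(\<Gamma> :: 'a set) (S :: 'a list) (k :: nat) (Y :: 'a list list).
        finite \<Gamma> \<and> set S \<subseteq> \<Gamma> \<and> parsing Y S \<and> (\<forall>y\<in>set Y. k \<le> length y) \<longrightarrow>
        (let L = map length Y in
          real (length Y) * entropy (set Y) 1 Y
            \<le> real (length S) * entropy \<Gamma> k S + real (length L) * entropy0 L))
     \<and>
     (\<forall>(F :: 'i filter) (\<Gamma> :: 'i \<Rightarrow> 'a set) (S :: 'i \<Rightarrow> 'a list) (k :: 'i \<Rightarrow> nat)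
        (Y :: 'i \<Rightarrow> 'a list list).
        (\<forall>i. finite (\<Gamma> i) \<and> 2 \<le> card (\<Gamma> i) \<and> set (S i) \<subseteq> \<Gamma> i \<and> parsing (Y i) (S i)
             \<and> (\<forall>y\<in>set (Y i). k i \<le> length y)) \<and>
        filterlim (\<lambda>i. length (S i)) at_top F \<and>
        (\<lambda>i. real (length (Y i)))
          \<in> O[F](\<lambda>i. real (length (S i)) / log (real (card (\<Gamma> i))) (real (length (S i)))) \<longrightarrow>
        (\<exists>g :: 'i \<Rightarrow> real.
           g \<in> O[F](\<lambda>i. real (length (S i)) * log 2 (log 2 (real (length (S i))))
                         / log (real (card (\<Gamma> i))) (real (length (S i)))) \<and>
           (\<forall>i. real (length (Y i)) * entropy (set (Y i)) 1 (Y i)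
                  \<le> real (length (S i)) * entropy (\<Gamma> i) (k i) (S i) + g i)))"
proof (intro conjI allI impI, goal_cases)
  case (1 \<Gamma> S k Y)
  then show ?case using entropy_parsing_le[of \<Gamma> S Y k] by (simp add: Let_def)
next
  case (2 F \<Gamma> S k Y)
  then show ?case
    \<comment> \<open>With the length entropy itself as \<open>g\<close>, the inequality for every
      \<open>i\<close> is the first claim.\<close>
    by (intro exI[of _ "\<lambda>i. real (length (Y i)) * entropy0 (map length (Y i))"]
        conjI allI parsing_lengths_entropy_bigo entropy_parsing_le) auto
qed

end
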